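(* Let $G$ be a finite simple connected graph with $N_0$ vertices, $E_0$ edges and circuit rank $r=E_0-N_0+1$. For every $n>0$, the Kemeny constant of the iterated subdivision graph satisfies $$K(s^n(G))=4K(s^{n-1}(G))+r-\frac12,$$ and consequently $$K(s^n(G))=4^nK(G)+\frac{4^n-1}{3}\left(r-\frac12\right).$$
   Context: The subdivision graph $s(H)$ of a graph $H$ is obtained from $H$ by inserting one new vertex on every edge of $H$; $s^0(G)=G$ and $s^n(G)=s(s^{n-1}(G))$. For a connected graph $H$, the Kemeny constant $K(H)$ is the expected number of steps for a simple (unbiased) random walk on $H$ started at a vertex $i$ to hit a target vertex $j$ chosen at random according to the stationary distribution of the walk ($\pi_j=d_j/\sum_k d_k$), with hitting time $0$ if $j=i$; this quantity does not depend on $i$. Equivalently, $K(H)=\sum_{k\geqslant 2}1/\lambda_k$, where $0=\lambda_1<\lambda_2\leqslant\cdots$ are the eigenvalues of the normalized Laplacian $I-D^{-1/2}AD^{-1/2}$ of $H$. *)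

theory Defs
  imports "Graph_Theory.Graph_Theory" "HOL-Probability.Probability" "HOL-Library.Uprod"
begin

text \<open>
  A finite simple undirected graph is a \<open>pair_graph\<close>: a finite, symmetric, loop-free digraph
  without parallel arcs. An undirected edge is the unordered pair of the ends of an arc, so each
  edge corresponds to two opposite arcs.
\<close>

definition uedges :: "'a pair_pre_digraph \<Rightarrow> 'a uprod set" where
  "uedges G = (\<lambda>(u, v). Upair u v) ` parcs G"

definition circuit_rank :: "'a pair_pre_digraph \<Rightarrow> int" where
  "circuit_rank G = int (card (uedges G)) - int (card (pverts G)) + 1"


section \<open>Iterated subdivision graphs\<close>

text \<open>
  Iterating the construction needs one vertex type that is closed under it. \<open>Old\<close> tags the
  vertices inherited from the graph being subdivided and \<open>Mid e\<close> is the vertex inserted on the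
  edge \<open>e\<close>, so inserted vertices are new by construction. \<open>Base\<close> tags the vertices of the
  initial graph, hence \<open>iter_subdiv 0 G\<close> is a copy of \<open>G\<close>.
\<close>

datatype 'a svert = Base 'a | Old "'a svert" | Mid "'a svert uprod"

definition subdiv_graph :: "'a svert pair_pre_digraph \<Rightarrow> 'a svert pair_pre_digraph" where
  "subdiv_graph H =
     \<lparr> pverts = Old ` pverts H \<union> Mid ` uedges H,
       parcs = {(Old u, Mid e) | u e. e \<in> uedges H \<and> u \<in> set_uprod e}
             \<union> {(Mid e, Old u) | u e. e \<in> uedges H \<and> u \<in> set_uprod e} \<rparr>"

definition base_copy :: "'a pair_pre_digraph \<Rightarrow> 'a svert pair_pre_digraph" where
  "base_copy G = \<lparr> pverts = Base ` pverts G, parcs = map_prod Base Base ` parcs G \<rparr>"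

definition iter_subdiv :: "nat \<Rightarrow> 'a pair_pre_digraph \<Rightarrow> 'a svert pair_pre_digraph" where
  "iter_subdiv n G = (subdiv_graph ^^ n) (base_copy G)"


section \<open>The simple random walk and the Kemeny constant\<close>

text \<open>
  \<open>walk G i n\<close> is the law of the trajectory \<open>[X\<^sub>0, \<dots>, X\<^sub>n]\<close> of the simple random walk with
  \<open>X\<^sub>0 = i\<close>. (If some vertex has no neighbour, \<open>pmf_of_set\<close> is applied to the empty set and the
  walk is meaningless.)
\<close>

primrec walk :: "'a pair_pre_digraph \<Rightarrow> 'a \<Rightarrow> nat \<Rightarrow> 'a list pmf" where
  "walk G i 0 = return_pmf [i]"
| "walk G i (Suc n) =
     bind_pmf (walk G i n) (\<lambda>xs.
       map_pmf (\<lambda>v. xs @ [v]) (pmf_of_set {v. (last xs, v) \<in> parcs G}))"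

text \<open>
  \<open>hit_prob G i j n\<close> is the probability that the hitting time \<open>T = min {m. X\<^sub>m = j}\<close> equals \<open>n\<close>,
  an event determined by the first \<open>n\<close> steps. The expectation of \<open>T\<close> is \<open>\<Sum>n. n * P(T = n)\<close>;
  on a finite connected graph with at least two vertices \<open>T\<close> is almost surely finite and the
  series converges.
\<close>

definition hit_prob :: "'a pair_pre_digraph \<Rightarrow> 'a \<Rightarrow> 'a \<Rightarrow> nat \<Rightarrow> real" where
  "hit_prob G i j n =
     measure_pmf.prob (walk G i n) {xs. xs ! n = j \<and> (\<forall>m<n. xs ! m \<noteq> j)}"

definition expected_hitting_time :: "'a pair_pre_digraph \<Rightarrow> 'a \<Rightarrow> 'a \<Rightarrow> real" where
  "expected_hitting_time G i j = (\<Sum>n. real n * hit_prob G i j n)"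

definition stationary :: "'a pair_pre_digraph \<Rightarrow> 'a \<Rightarrow> real" where
  "stationary G j =
     real (out_degree (with_proj G) j) / (\<Sum>k\<in>pverts G. real (out_degree (with_proj G) k))"

definition kemeny_from :: "'a pair_pre_digraph \<Rightarrow> 'a \<Rightarrow> real" where
  "kemeny_from G i = (\<Sum>j\<in>pverts G. stationary G j * expected_hitting_time G i j)"

text \<open>The Kemeny constant is the common value of \<open>kemeny_from G i\<close> over all starting vertices.\<close>

definition kemeny :: "'a pair_pre_digraph \<Rightarrow> real" where
  "kemeny G = (THE K. \<forall>i\<in>pverts G. kemeny_from G i = K)"

end

theory Submission
  imports Defs
begin

text \<open>
  Let \<open>P\<close> be the transition matrix and \<open>\<pi>\<close> the stationary row vector. Any solution \<open>M\<close> of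
  \<open>(I - P) M = I - 1 \<pi>\<close> recovers the hitting times as \<open>h i j = (M j j - M i j) / \<pi> j\<close>, so the Kemeny
  constant is the trace of \<open>M\<close> minus its row sum, which is the same for all rows; a solution is
  \<open>M i j = - \<pi> j * h i j\<close>. For the subdivision graph the equation can be solved blockwise in terms
  of a solution for the original graph. This multiplies the row sum by \<open>4\<close> and turns the trace
  \<open>tr M\<close> into \<open>4 tr M + E - N + 1/2\<close>.
\<close>

section \<open>Neighbourhood averages\<close>

definition nbr :: "'a pair_pre_digraph \<Rightarrow> 'a \<Rightarrow> 'a set" where
  "nbr G u = {v. (u, v) \<in> parcs G}"

definition deg :: "'a pair_pre_digraph \<Rightarrow> 'a \<Rightarrow> real" where
  "deg G u = real (card (nbr G u))"

definition vol :: "'a pair_pre_digraph \<Rightarrow> real" where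
  "vol G = (\<Sum>u\<in>pverts G. deg G u)"

text \<open>The transition operator \<open>P\<close> of the walk, applied to a column
  \<open>f\<close>.\<close>

definition avg :: "'a pair_pre_digraph \<Rightarrow> ('a \<Rightarrow> real) \<Rightarrow> 'a \<Rightarrow> real" where
  "avg G f u = (\<Sum>v\<in>nbr G u. f v) / deg G u"

lemma avg_cong: "(\<And>v. v \<in> nbr G u \<Longrightarrow> f v = g v) \<Longrightarrow> avg G f u = avg G g u"
  unfolding avg_def by simp

text \<open>Two vertices and reachability give every vertex a neighbour, so the walk is well defined
  and no degree in a denominator vanishes.\<close>

locale conn_graph = pair_graph G for G :: "'a pair_pre_digraph" +
  assumes reach: "u \<in> pverts G \<Longrightarrow> v \<in> pverts G \<Longrightarrow> (u, v) \<in> (parcs G)\<^sup>*"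
    and two_verts: "2 \<le> card (pverts G)"
begin

lemma nbr_verts: "nbr G u \<subseteq> pverts G"
  unfolding nbr_def using in_arcsD2 by auto

lemma finite_nbr [simp]: "finite (nbr G u)"
  using nbr_verts pair_finite_verts finite_subset by blast

lemma nbr_sym: "v \<in> nbr G u \<longleftrightarrow> u \<in> nbr G v"
  unfolding nbr_def using arcs_symmetric by blast

lemma nbr_ne:
  assumes "u \<in> pverts G"
  shows "nbr G u \<noteq> {}"
proof -
  obtain v where v: "v \<in> pverts G" "v \<noteq> u"
    using two_verts by (metis One_nat_def card.empty card_le_Suc0_iff_eq numeral_2_eq_2 not_less_eq_eq
      pair_finite_verts assms)
  then have "(u, v) \<in> (parcs G)\<^sup>*" using reach assms by blast
  with v(2) show ?thesis unfolding nbr_def by (metis (mono_tags) converse_rtranclE empty_iff mem_Collect_eq)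
qed

lemma deg_pos: "u \<in> pverts G \<Longrightarrow> 0 < deg G u"
  unfolding deg_def using nbr_ne by (simp add: card_gt_0_iff)

lemma vol_pos: "0 < vol G"
proof -
  have "pverts G \<noteq> {}" using two_verts by auto
  then show ?thesis unfolding vol_def using deg_pos pair_finite_verts by (intro sum_pos) auto
qed

lemma avg_mono: "(\<And>v. v \<in> pverts G \<Longrightarrow> f v \<le> g v) \<Longrightarrow> avg G f u \<le> avg G g u"
  unfolding avg_def deg_def using nbr_verts by (intro divide_right_mono sum_mono) auto

lemma avg_const: "u \<in> pverts G \<Longrightarrow> avg G (\<lambda>_. c) u = c"
  using nbr_ne[of u] unfolding avg_def deg_def by simp

lemma avg_add: "avg G (\<lambda>v. f v + g v) u = avg G f u + avg G g u"
  unfolding avg_def by (simp add: sum.distrib add_divide_distrib)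

lemma avg_diff: "avg G (\<lambda>v. f v - g v) u = avg G f u - avg G g u"
  unfolding avg_def by (simp add: sum_subtractf diff_divide_distrib)

lemma avg_scale: "avg G (\<lambda>v. c * f v) u = c * avg G f u"
  unfolding avg_def by (simp add: sum_distrib_left)

lemma avg_sum: "avg G (\<lambda>v. \<Sum>k\<in>A. f k v) u = (\<Sum>k\<in>A. avg G (f k) u)"
  unfolding avg_def by (simp add: sum.swap[of _ A] sum_divide_distrib)

lemma abs_avg_le: "\<bar>avg G f u\<bar> \<le> avg G (\<lambda>v. \<bar>f v\<bar>) u"
  unfolding avg_def deg_def by (simp add: divide_right_mono)

lemma deg_avg: "deg G u * avg G f u = (\<Sum>v\<in>nbr G u. f v)" if "u \<in> pverts G"
  using deg_pos[OF that] unfolding avg_def by simp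

lemma sum_arcs: "(\<Sum>(u, v)\<in>parcs G. f u v) = (\<Sum>u\<in>pverts G. \<Sum>v\<in>nbr G u. f u v)"
proof -
  have "parcs G = Sigma (pverts G) (nbr G)"
    unfolding nbr_def using in_arcsD1 by auto
  then show ?thesis
    by (simp add: sum.Sigma pair_finite_verts)
qed

lemma sum_arcs_swap: "(\<Sum>(u, v)\<in>parcs G. f v u) = (\<Sum>(u, v)\<in>parcs G. (f u v :: real))"
  by (rule sum.reindex_bij_witness[of _ prod.swap prod.swap]) (auto intro: arcs_symmetric)

text \<open>Invariance of the degree weights under \<open>P\<close>: reversing all arcs permutes
  them, so it does not matter which end of the arc \<open>f\<close> is evaluated at.\<close>

lemma sum_deg_avg: "(\<Sum>u\<in>pverts G. deg G u * avg G f u) = (\<Sum>u\<in>pverts G. deg G u * f u)"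
proof -
  have "(\<Sum>u\<in>pverts G. deg G u * avg G f u) = (\<Sum>(u, v)\<in>parcs G. f v)"
    by (simp add: deg_avg sum_arcs)
  also have "\<dots> = (\<Sum>(u, v)\<in>parcs G. f u)"
    by (rule sum_arcs_swap)
  also have "\<dots> = (\<Sum>u\<in>pverts G. deg G u * f u)"
    by (simp add: sum_arcs deg_def)
  finally show ?thesis .
qed

section \<open>Contraction and uniqueness away from a target vertex\<close>

text \<open>The weight is \<open>2 - \<epsilon>\<^sup>d\<close> with \<open>d\<close> the distance to \<open>j\<close>; \<open>\<epsilon>\<close> is so small that the neighbour
  one step closer to \<open>j\<close> alone makes the average of \<open>\<epsilon>\<^sup>d\<close> at least \<open>2 \<epsilon>\<^sup>d\<close>.\<close>

lemma contracting_weight: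
  assumes j: "j \<in> pverts G"
  obtains w \<rho> where "0 \<le> \<rho>" "\<rho> < 1" "\<And>i. i \<in> pverts G \<Longrightarrow> 1 \<le> w i"
    "\<And>i. i \<in> pverts G \<Longrightarrow> i \<noteq> j \<Longrightarrow> avg G w i \<le> \<rho> * w i"
proof -
  define N where "N = real (card (pverts G))"
  have N: "N \<ge> 2" using two_verts unfolding N_def by linarith
  define \<epsilon> where "\<epsilon> = 1 / (2 * N)"
  have \<epsilon>: "0 < \<epsilon>" "\<epsilon> < 1" using N unfolding \<epsilon>_def by auto
  define d where "d i = (LEAST n. (i, j) \<in> parcs G ^^ n)" for i
  define \<phi> where "\<phi> i = \<epsilon> ^ d i" for i
  have \<phi>: "0 < \<phi> i" "\<phi> i \<le> 1" for i
    unfolding \<phi>_def using \<epsilon> by (auto intro: power_le_one)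
  have step: "2 * \<phi> i \<le> avg G \<phi> i" if i: "i \<in> pverts G" "i \<noteq> j" for i
  proof -
    have "\<exists>n. (i, j) \<in> parcs G ^^ n" using reach[OF i(1) j] rtrancl_imp_relpow by blast
    then have di: "(i, j) \<in> parcs G ^^ d i" unfolding d_def by (rule LeastI_ex)
    with i obtain m where m: "d i = Suc m" by (cases "d i") auto
    with di obtain k where k: "(i, k) \<in> parcs G" "(k, j) \<in> parcs G ^^ m"
      by (metis relpow_Suc_D2)
    have "d k \<le> m" unfolding d_def using k(2) by (rule Least_le)
    then have "\<epsilon> ^ m \<le> \<phi> k" unfolding \<phi>_def using \<epsilon> by (intro power_decreasing) auto
    moreover have "\<epsilon> ^ m = 2 * N * \<phi> i" unfolding \<phi>_def m using N by (simp add: \<epsilon>_def)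
    ultimately have 1: "2 * N * \<phi> i \<le> \<phi> k" by simp
    have "deg G i \<le> N" unfolding deg_def N_def
      using card_mono[OF pair_finite_verts nbr_verts] by simp
    then have "deg G i * (2 * \<phi> i) \<le> N * (2 * \<phi> i)"
      using \<phi>(1)[of i] by (intro mult_right_mono) auto
    also have "\<dots> \<le> \<phi> k" using 1 by simp
    also have "\<dots> \<le> (\<Sum>v\<in>nbr G i. \<phi> v)"
      using k(1) \<phi>(1) by (intro member_le_sum) (auto simp: nbr_def[symmetric] less_imp_le, simp add: nbr_def)
    finally show ?thesis unfolding avg_def using deg_pos[OF i(1)] by (simp add: field_simps)
  qed
  define \<delta> where "\<delta> = Min (\<phi> ` pverts G)"
  have ne: "pverts G \<noteq> {}" using j by auto
  have \<delta>: "0 < \<delta>" unfolding \<delta>_def using ne pair_finite_verts \<phi> by (subst Min_gr_iff) auto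
  have \<delta>_le: "\<delta> \<le> \<phi> i" if "i \<in> pverts G" for i
    unfolding \<delta>_def using that pair_finite_verts by auto
  have \<delta>1: "\<delta> \<le> 1" using \<delta>_le[OF j] \<phi>(2)[of j] by simp
  show thesis
  \<comment> \<open>With \<open>w = 2 - \<phi>\<close>, the contraction reduces to
    \<open>\<delta> - \<delta> * \<phi> i / 2 \<le> \<phi> i\<close>, which holds because
    \<open>\<delta>\<close> is the minimum of \<open>\<phi>\<close>.\<close>
  proof (rule that[of "1 - \<delta> / 2" "\<lambda>i. 2 - \<phi> i"])
    fix i assume i: "i \<in> pverts G" "i \<noteq> j"
    have "avg G (\<lambda>i. 2 - \<phi> i) i = 2 - avg G \<phi> i"
      using i by (simp add: avg_diff avg_const)
    also have "\<dots> \<le> 2 - 2 * \<phi> i" using step[OF i] by simp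
    also have "\<dots> \<le> (1 - \<delta> / 2) * (2 - \<phi> i)"
    proof -
      have "0 \<le> \<delta> * \<phi> i" using \<delta> \<phi>(1)[of i] by simp
      then show ?thesis using \<delta>_le[OF i(1)] by (simp add: algebra_simps)
    qed
    finally show "avg G (\<lambda>i. 2 - \<phi> i) i \<le> (1 - \<delta> / 2) * (2 - \<phi> i)" .
  qed (use \<delta> \<delta>1 \<phi> in auto)
qed

text \<open>Every application of \<open>P\<close> off \<open>j\<close> gains a factor \<rho> in a
  bound of the absolute value by a multiple of \<open>w\<close>, so the bound tends to 0. All later
  uniqueness claims rest on this lemma.\<close>

lemma harmonic_off_zero:
  assumes j: "j \<in> pverts G" and fj: "f j = 0"
    and h: "\<And>i. i \<in> pverts G \<Longrightarrow> i \<noteq> j \<Longrightarrow> f i = avg G f i"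
    and i: "i \<in> pverts G"
  shows "f i = 0"
proof -
  obtain w \<rho> where \<rho>: "0 \<le> \<rho>" "\<rho> < 1" and w1: "\<And>i. i \<in> pverts G \<Longrightarrow> 1 \<le> w i"
    and w: "\<And>i. i \<in> pverts G \<Longrightarrow> i \<noteq> j \<Longrightarrow> avg G w i \<le> \<rho> * w i"
    by (rule contracting_weight[OF j]) (rule that)
  define C where "C = (\<Sum>i\<in>pverts G. \<bar>f i\<bar>)"
  have C0: "0 \<le> C" unfolding C_def by (simp add: sum_nonneg)
  have b: "\<bar>f i\<bar> \<le> C * \<rho> ^ n * w i" if "i \<in> pverts G" for i n
    using that
  proof (induction n arbitrary: i)
    case 0
    have "\<bar>f i\<bar> \<le> C" unfolding C_def using 0 pair_finite_verts by (intro member_le_sum) auto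
    also have "\<dots> \<le> C * w i" using mult_left_mono[OF w1[OF 0] C0] by simp
    finally show ?case by simp
  next
    case (Suc n)
    show ?case
    proof (cases "i = j")
      case True
      then show ?thesis using fj C0 \<rho> w1[OF Suc.prems] by simp
    next
      case False
      have "\<bar>f i\<bar> \<le> avg G (\<lambda>v. \<bar>f v\<bar>) i"
        using h[OF Suc.prems False] abs_avg_le[of f i] by simp
      also have "\<dots> \<le> avg G (\<lambda>v. C * \<rho> ^ n * w v) i"
        by (rule avg_mono) (rule Suc.IH)
      also have "\<dots> = C * \<rho> ^ n * avg G w i"
        by (rule avg_scale)
      also have "\<dots> \<le> C * \<rho> ^ n * (\<rho> * w i)"
        using w[OF Suc.prems False] C0 \<rho> by (intro mult_left_mono) auto
      finally show ?thesis by (simp add: mult_ac)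
    qed
  qed
  have "(\<lambda>n. C * \<rho> ^ n * w i) \<longlonglongrightarrow> C * 0 * w i"
    using \<rho> by (intro tendsto_intros LIMSEQ_power_zero) auto
  then have "\<bar>f i\<bar> \<le> C * 0 * w i"
    by (rule LIMSEQ_le_const) (use b[OF i] in blast)
  then show ?thesis by simp
qed

end

section \<open>Hitting times\<close>

lemma length_walk: "xs \<in> set_pmf (walk G i n) \<Longrightarrow> length xs = Suc n"
  by (induction n arbitrary: xs) auto

text \<open>\<open>walk\<close> grows at its end, whereas first-step analysis has to split off its
  beginning; associativity of \<open>bind_pmf\<close> exchanges the two.\<close>

lemma walk_first_step:
  "walk G i (Suc n) = bind_pmf (pmf_of_set (nbr G i)) (\<lambda>k. map_pmf ((#) i) (walk G k n))"
proof (induction n)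
  case 0
  show ?case by (simp add: nbr_def map_pmf_def bind_return_pmf)
next
  case (Suc n)
  have "walk G i (Suc (Suc n)) = bind_pmf (pmf_of_set (nbr G i)) (\<lambda>k. bind_pmf (walk G k n)
      (\<lambda>xs. map_pmf (\<lambda>v. (i # xs) @ [v]) (pmf_of_set {v. (last (i # xs), v) \<in> parcs G})))"
    by (subst walk.simps(2), subst Suc)
      (simp only: bind_assoc_pmf bind_map_pmf)
  \<comment> \<open>Trajectories are nonempty by \<open>length_walk\<close>, so the prefix
    \<open>i\<close> does not change their last entry.\<close>
  also have "\<dots> = bind_pmf (pmf_of_set (nbr G i)) (\<lambda>k. bind_pmf (walk G k n)
      (\<lambda>xs. map_pmf (\<lambda>v. (i # xs) @ [v]) (pmf_of_set {v. (last xs, v) \<in> parcs G})))"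
    by (intro bind_pmf_cong refl) (auto dest!: length_walk)
  also have "\<dots> = bind_pmf (pmf_of_set (nbr G i)) (\<lambda>k. map_pmf ((#) i) (walk G k (Suc n)))"
    by (simp add: map_bind_pmf pmf.map_comp o_def)
  finally show ?case .
qed

lemma prob_bind_pmf:
  "measure_pmf.prob (bind_pmf p f) A = measure_pmf.expectation p (\<lambda>x. measure_pmf.prob (f x) A)"
  unfolding measure_pmf_bind
  by (rule measure_pmf.measure_bind[where N = "count_space UNIV"]) (auto simp: measure_pmf_in_subprob_algebra)

lemma hit_prob_0: "hit_prob G i j 0 = of_bool (i = j)"
  unfolding hit_prob_def by (simp add: indicator_def)

lemma hit_prob_nonneg: "0 \<le> hit_prob G i j n"
  unfolding hit_prob_def by simp

context conn_graph
begin

lemma hit_prob_Suc: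
  assumes i: "i \<in> pverts G"
  shows "hit_prob G i j (Suc n) = (if i = j then 0 else avg G (\<lambda>k. hit_prob G k j n) i)"
proof -
  let ?A = "\<lambda>n. {xs. xs ! n = j \<and> (\<forall>m<n. xs ! m \<noteq> j)}"
  \<comment> \<open>Prefixing \<open>i\<close> shifts all indices by one. For \<open>i = j\<close>
    the target is already hit at index 0, which excludes a first hit at
    \<open>Suc n\<close>.\<close>
  have vim: "(#) i -` ?A (Suc n) = (if i = j then {} else ?A n)"
    by (auto simp: less_Suc_eq_0_disj)
  have "hit_prob G i j (Suc n) =
      (\<Sum>k\<in>nbr G i. measure_pmf.prob (map_pmf ((#) i) (walk G k n)) (?A (Suc n))) / card (nbr G i)"
    unfolding hit_prob_def walk_first_step
    by (simp only: prob_bind_pmf integral_pmf_of_set[OF nbr_ne[OF i] finite_nbr])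
  also have "\<dots> = (if i = j then 0 else avg G (\<lambda>k. hit_prob G k j n) i)"
    unfolding measure_map_pmf vim avg_def deg_def hit_prob_def by simp
  finally show ?thesis .
qed

text \<open>By the first-step recursion, \<open>\<rho> ^ n * w i\<close> dominates the hitting
  probabilities; the maximum of \<open>w\<close> makes the constant uniform in
  \<open>i\<close>.\<close>

lemma hit_prob_geometric:
  assumes j: "j \<in> pverts G"
  obtains C \<rho> where "0 \<le> \<rho>" "\<rho> < 1" "\<And>i n. i \<in> pverts G \<Longrightarrow> hit_prob G i j n \<le> C * \<rho> ^ n"
proof -
  obtain w \<rho> where \<rho>: "0 \<le> \<rho>" "\<rho> < 1" and w1: "\<And>i. i \<in> pverts G \<Longrightarrow> 1 \<le> w i"
    and w: "\<And>i. i \<in> pverts G \<Longrightarrow> i \<noteq> j \<Longrightarrow> avg G w i \<le> \<rho> * w i"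
    by (rule contracting_weight[OF j]) (rule that)
  have b: "hit_prob G i j n \<le> \<rho> ^ n * w i" if "i \<in> pverts G" for i n
    using that
  proof (induction n arbitrary: i)
    case 0
    then show ?case using w1[OF 0] by (cases "i = j") (auto simp: hit_prob_0)
  next
    case (Suc n)
    show ?case
    proof (cases "i = j")
      case True
      then show ?thesis using \<rho> w1[OF Suc.prems] by (simp add: hit_prob_Suc[OF j])
    next
      case False
      have "hit_prob G i j (Suc n) \<le> avg G (\<lambda>v. \<rho> ^ n * w v) i"
        using False Suc by (simp add: hit_prob_Suc avg_mono)
      also have "\<dots> = \<rho> ^ n * avg G w i"
        by (rule avg_scale)
      also have "\<dots> \<le> \<rho> ^ n * (\<rho> * w i)"
        using w[OF Suc.prems False] \<rho> by (intro mult_left_mono) auto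
      finally show ?thesis by (simp add: mult_ac)
    qed
  qed
  have "hit_prob G i j n \<le> Max (w ` pverts G) * \<rho> ^ n" if "i \<in> pverts G" for i n
  proof -
    have "\<rho> ^ n * w i \<le> \<rho> ^ n * Max (w ` pverts G)"
      using that pair_finite_verts \<rho> by (intro mult_left_mono) auto
    with b[OF that, of n] show ?thesis by (simp add: mult_ac)
  qed
  with \<rho> that show thesis by blast
qed

lemma summable_hit_prob:
  assumes i: "i \<in> pverts G" and j: "j \<in> pverts G"
  shows "summable (hit_prob G i j)" "summable (\<lambda>n. real n * hit_prob G i j n)"
proof -
  obtain C \<rho> where \<rho>: "0 \<le> \<rho>" "\<rho> < 1"
    and b: "\<And>i n. i \<in> pverts G \<Longrightarrow> hit_prob G i j n \<le> C * \<rho> ^ n"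
    by (rule hit_prob_geometric[OF j]) (rule that)
  have s: "summable (\<lambda>n. C * \<rho> ^ n)" using \<rho> by (intro summable_mult summable_geometric) auto
  show "summable (hit_prob G i j)"
    by (rule summable_comparison_test'[OF s, of 0])
      (use b[OF i] in \<open>simp add: abs_of_nonneg hit_prob_nonneg\<close>)
  \<comment> \<open>This is the termwise derivative of the geometric series, with coefficients
    \<open>Suc n\<close>.\<close>
  have "summable (\<lambda>n. diffs (\<lambda>_. 1) n * \<rho> ^ n)"
    using \<rho> by (intro termdiff_converges[of _ 1]) (auto intro: summable_geometric)
  then have s': "summable (\<lambda>n. C * (real (Suc n) * \<rho> ^ n))"
    by (intro summable_mult) (simp add: diffs_def)
  show "summable (\<lambda>n. real n * hit_prob G i j n)"
  proof (rule summable_comparison_test'[OF s', of 0])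
    fix n
    have "real n * hit_prob G i j n \<le> real (Suc n) * (C * \<rho> ^ n)"
      by (intro mult_mono b[OF i] hit_prob_nonneg) auto
    then show "norm (real n * hit_prob G i j n) \<le> C * (real (Suc n) * \<rho> ^ n)"
      using hit_prob_nonneg[of G i j n] by (simp add: mult_ac abs_mult)
  qed
qed

section \<open>First-step equations for the hitting times\<close>

lemma suminf_avg:
  assumes "\<And>k. k \<in> pverts G \<Longrightarrow> summable (f k)"
  shows "(\<Sum>n. avg G (\<lambda>k. f k n) i) = avg G (\<lambda>k. \<Sum>n. f k n) i"
proof -
  have s: "\<And>k. k \<in> nbr G i \<Longrightarrow> summable (f k)"
    using assms nbr_verts[of i] by blast
  have s': "summable (\<lambda>n. \<Sum>k\<in>nbr G i. f k n)"
    by (rule summable_sum) (rule s)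
  show ?thesis
    unfolding avg_def using suminf_divide[OF s'] by (simp add: suminf_sum s)
qed

text \<open>The target is hit almost surely: the total probability minus 1 vanishes at
  \<open>j\<close> and is harmonic elsewhere.\<close>

lemma suminf_hit_prob:
  assumes i: "i \<in> pverts G" and j: "j \<in> pverts G"
  shows "(\<Sum>n. hit_prob G i j n) = 1"
proof -
  let ?U = "\<lambda>i. \<Sum>n. hit_prob G i j n"
  have "?U i - 1 = 0"
  proof (rule harmonic_off_zero[OF j _ _ i, of "\<lambda>i. ?U i - 1"])
    have "?U j = hit_prob G j j 0 + (\<Sum>n. hit_prob G j j (Suc n))"
      using suminf_split_head[OF summable_hit_prob(1)[OF j j]] by simp
    then show "?U j - 1 = 0" using j by (simp add: hit_prob_0 hit_prob_Suc)
  next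
    fix i assume i: "i \<in> pverts G" "i \<noteq> j"
    have "?U i = hit_prob G i j 0 + (\<Sum>n. hit_prob G i j (Suc n))"
      using suminf_split_head[OF summable_hit_prob(1)[OF i(1) j]] by simp
    also have "\<dots> = (\<Sum>n. avg G (\<lambda>k. hit_prob G k j n) i)"
      using i by (simp add: hit_prob_0 hit_prob_Suc)
    also have "\<dots> = avg G ?U i"
      using summable_hit_prob(1)[OF _ j] by (rule suminf_avg)
    finally show "?U i - 1 = avg G (\<lambda>i. ?U i - 1) i"
      using i by (simp add: avg_diff avg_const)
  qed
  then show ?thesis by simp
qed

lemma hitting_time_self: "j \<in> pverts G \<Longrightarrow> expected_hitting_time G j j = 0"
proof -
  assume j: "j \<in> pverts G"
  have "real n * hit_prob G j j n = 0" for n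
    using j by (cases n) (auto simp: hit_prob_Suc)
  then show ?thesis unfolding expected_hitting_time_def by (simp only: suminf_zero)
qed

lemma hitting_time_step:
  assumes i: "i \<in> pverts G" and j: "j \<in> pverts G" and ij: "i \<noteq> j"
  shows "expected_hitting_time G i j = 1 + avg G (\<lambda>k. expected_hitting_time G k j) i"
proof -
  let ?u = "\<lambda>k n. hit_prob G k j n"
  note s = summable_hit_prob[OF _ j]
  have s': "summable (\<lambda>n. real n * ?u k n + ?u k n)" if "k \<in> pverts G" for k
    using s[OF that] by (rule summable_add[rotated])
  \<comment> \<open>The term at 0 vanishes. Writing \<open>Suc n\<close> as \<open>n + 1\<close>
    separates the expectation after the first step from a total probability, which is 1.\<close>
  have "expected_hitting_time G i j = (\<Sum>n. real (Suc n) * ?u i (Suc n))"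
    unfolding expected_hitting_time_def using suminf_split_head[OF s(2)[OF i]] by simp
  also have "\<dots> = (\<Sum>n. avg G (\<lambda>k. real n * ?u k n + ?u k n) i)"
    using i ij by (simp add: hit_prob_Suc avg_add avg_scale algebra_simps)
  also have "\<dots> = avg G (\<lambda>k. \<Sum>n. real n * ?u k n + ?u k n) i"
    using s' by (rule suminf_avg)
  also have "\<dots> = avg G (\<lambda>k. expected_hitting_time G k j + 1) i"
    unfolding expected_hitting_time_def
    using nbr_verts[of i]
    by (intro avg_cong) (auto simp: suminf_add[symmetric] s suminf_hit_prob j)
  also have "\<dots> = 1 + avg G (\<lambda>k. expected_hitting_time G k j) i"
    using i by (simp add: avg_add avg_const)
  finally show ?thesis .
qed

text \<open>The constant 1 cancels in the difference of two solutions, which is therefore harmonic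
  off \<open>j\<close> and zero at \<open>j\<close>.\<close>

lemma hitting_time_unique:
  assumes j: "j \<in> pverts G" and "f j = 0"
    and "\<And>i. i \<in> pverts G \<Longrightarrow> i \<noteq> j \<Longrightarrow> f i = 1 + avg G f i"
    and i: "i \<in> pverts G"
  shows "expected_hitting_time G i j = f i"
proof -
  have "expected_hitting_time G i j - f i = 0"
    by (rule harmonic_off_zero[OF j _ _ i])
      (use assms in \<open>auto simp: hitting_time_self hitting_time_step[OF _ j] avg_diff\<close>)
  then show ?thesis by simp
qed

section \<open>The Kemeny constant as a trace\<close>

lemma stationary_eq: "stationary G j = deg G j / vol G"
proof -
  have "out_arcs (with_proj G) u = Pair u ` nbr G u" for u
    unfolding out_arcs_def nbr_def by auto
  then have "real (out_degree (with_proj G) u) = deg G u" for u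
    unfolding out_degree_def deg_def by (simp add: card_image inj_on_def)
  then show ?thesis unfolding stationary_def vol_def by simp
qed

end

text \<open>\<open>fundamental G M\<close> is the matrix equation \<open>(I - P) M = I - 1 \<pi>\<^sup>T\<close>, whose solutions are
  determined up to adding a row vector to all rows.\<close>

definition fundamental :: "'a pair_pre_digraph \<Rightarrow> ('a \<Rightarrow> 'a \<Rightarrow> real) \<Rightarrow> bool" where
  "fundamental G M \<longleftrightarrow> (\<forall>i\<in>pverts G. \<forall>j\<in>pverts G.
     M i j - avg G (\<lambda>k. M k j) i = of_bool (i = j) - deg G j / vol G)"

context conn_graph
begin

text \<open>Off the diagonal, column \<open>j\<close> of \<open>(I - P) M\<close> is the constant
  \<open>- stationary G j\<close>. After rescaling, this is the first-step equation of the hitting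
  time of \<open>j\<close>.\<close>

lemma kemeny_from_fundamental:
  assumes M: "fundamental G M" and i: "i \<in> pverts G"
  shows "kemeny_from G i = (\<Sum>j\<in>pverts G. M j j) - (\<Sum>j\<in>pverts G. M i j)"
proof -
  have h: "stationary G j * expected_hitting_time G i j = M j j - M i j" if j: "j \<in> pverts G" for j
  proof -
    define p where "p = stationary G j"
    have p: "p > 0" unfolding p_def stationary_eq using deg_pos[OF j] vol_pos by simp
    have "expected_hitting_time G i j = (M j j - M i j) / p"
    proof (rule hitting_time_unique[OF j _ _ i])
      fix i assume i: "i \<in> pverts G" "i \<noteq> j"
      have "M i j - avg G (\<lambda>k. M k j) i = - p"
        using M i j unfolding fundamental_def p_def stationary_eq by simp
      moreover have "avg G (\<lambda>i. (M j j - M i j) / p) i = (M j j - avg G (\<lambda>k. M k j) i) / p"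
        using avg_scale[of "1 / p" "\<lambda>i. M j j - M i j"] i by (simp add: avg_diff avg_const)
      ultimately show "(M j j - M i j) / p = 1 + avg G (\<lambda>i. (M j j - M i j) / p) i"
        using p by (simp add: field_simps)
    qed simp
    then show ?thesis using p by (simp add: p_def)
  qed
  show ?thesis unfolding kemeny_from_def by (simp add: h sum_subtractf)
qed

text \<open>The rows of \<open>I - 1 pi\<close> sum to 0, so the column of row sums of
  \<open>M\<close> is harmonic at every vertex and hence constant.\<close>

lemma fundamental_row_sum:
  assumes M: "fundamental G M" and i: "i \<in> pverts G" and i': "i' \<in> pverts G"
  shows "(\<Sum>j\<in>pverts G. M i j) = (\<Sum>j\<in>pverts G. M i' j)"
proof -
  let ?s = "\<lambda>i. \<Sum>j\<in>pverts G. M i j"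
  have "?s i - ?s i' = 0"
  proof (rule harmonic_off_zero[OF i' _ _ i, of "\<lambda>i. ?s i - ?s i'"])
    fix i assume i: "i \<in> pverts G"
    have "?s i - avg G ?s i = (\<Sum>j\<in>pverts G. M i j - avg G (\<lambda>k. M k j) i)"
      by (simp add: avg_sum sum_subtractf)
    also have "\<dots> = (\<Sum>j\<in>pverts G. of_bool (i = j) - deg G j / vol G)"
      using M i unfolding fundamental_def by simp
    also have "\<dots> = 1 - vol G / vol G"
      using i pair_finite_verts unfolding vol_def
      by (simp add: sum_subtractf sum_divide_distrib[symmetric] of_bool_def)
    finally show "?s i - ?s i' = avg G (\<lambda>i. ?s i - ?s i') i"
      using i vol_pos by (simp add: avg_diff avg_const)
  qed simp
  then show ?thesis by simp
qed

lemma kemeny_eq_trace: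
  assumes M: "fundamental G M" and i: "i \<in> pverts G"
  shows "kemeny G = (\<Sum>j\<in>pverts G. M j j) - (\<Sum>j\<in>pverts G. M i j)"
  unfolding kemeny_def
proof (rule the_equality)
  show "\<forall>i'\<in>pverts G. kemeny_from G i' = (\<Sum>j\<in>pverts G. M j j) - (\<Sum>j\<in>pverts G. M i j)"
    using kemeny_from_fundamental[OF M] fundamental_row_sum[OF M i] by auto
next
  fix K assume "\<forall>i\<in>pverts G. kemeny_from G i = K"
  then show "K = (\<Sum>j\<in>pverts G. M j j) - (\<Sum>j\<in>pverts G. M i j)"
    using kemeny_from_fundamental[OF M i] i by auto
qed

text \<open>Kac's formula. By invariance, the degree-weighted sum of \<open>h - P h\<close> is 0.
  Off \<open>j\<close> the summands are the degrees by the first-step equation, which determines the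
  one at \<open>j\<close>.\<close>

lemma mean_return_time:
  assumes j: "j \<in> pverts G"
  shows "avg G (\<lambda>k. expected_hitting_time G k j) j = vol G / deg G j - 1"
proof -
  let ?h = "\<lambda>k. expected_hitting_time G k j"
  let ?g = "\<lambda>i. deg G i * ?h i - deg G i * avg G ?h i"
  have "0 = (\<Sum>i\<in>pverts G. ?g i)"
    by (simp add: sum_subtractf sum_deg_avg)
  also have "\<dots> = ?g j + (\<Sum>i\<in>pverts G - {j}. ?g i)"
    using pair_finite_verts j by (simp add: sum.remove)
  also have "(\<Sum>i\<in>pverts G - {j}. ?g i) = (\<Sum>i\<in>pverts G - {j}. deg G i)"
    by (intro sum.cong refl) (simp add: hitting_time_step[OF _ j] algebra_simps)
  also have "\<dots> = vol G - deg G j"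
    using pair_finite_verts j unfolding vol_def by (simp add: sum.remove)
  finally show ?thesis using deg_pos[OF j] j by (simp add: hitting_time_self field_simps)
qed

text \<open>Kac's formula yields the diagonal entries of the equation, the first-step equation the
  others.\<close>

lemma ex_fundamental: "\<exists>M. fundamental G M"
proof
  let ?h = "expected_hitting_time G"
  show "fundamental G (\<lambda>i j. (- deg G j / vol G) * ?h i j)"
    unfolding fundamental_def
  proof (intro ballI)
    fix i j assume i: "i \<in> pverts G" and j: "j \<in> pverts G"
    show "(- deg G j / vol G) * ?h i j - avg G (\<lambda>k. (- deg G j / vol G) * ?h k j) i
        = of_bool (i = j) - deg G j / vol G"
    proof (cases "i = j")
      case True
      then show ?thesis using j deg_pos[OF j] vol_pos
        by (simp only: avg_scale mean_return_time hitting_time_self) (simp add: field_simps)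
    next
      case False
      then show ?thesis using i j vol_pos
        by (simp only: avg_scale hitting_time_step[OF i j False]) (simp add: field_simps)
    qed
  qed
qed

section \<open>Sums over undirected edges\<close>

lemma Upair_in_uedges: "Upair u v \<in> uedges G \<longleftrightarrow> v \<in> nbr G u"
  unfolding uedges_def nbr_def using arcs_symmetric by auto

lemma uedgesE:
  assumes "e \<in> uedges G"
  obtains u v where "e = Upair u v" "v \<in> nbr G u" "u \<in> pverts G" "v \<in> pverts G" "u \<noteq> v"
  using assms unfolding uedges_def nbr_def
  using in_arcsD1 in_arcsD2 no_loops' by fastforce

lemma finite_uedges: "finite (uedges G)"
  unfolding uedges_def using pair_finite_arcs by simp

lemma set_uprod_verts: "e \<in> uedges G \<Longrightarrow> a \<in> set_uprod e \<Longrightarrow> a \<in> pverts G"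
  by (auto elim!: uedgesE)

lemma card_set_uprod: "e \<in> uedges G \<Longrightarrow> card (set_uprod e) = 2"
  by (auto elim!: uedgesE)

text \<open>The fibre over an edge consists of its two orientations, which are distinct because
  there are no loops.\<close>

lemma sum_arcs_uedges:
  "(\<Sum>(u, v)\<in>parcs G. f (Upair u v)) = 2 * (\<Sum>e\<in>uedges G. f e :: real)"
proof -
  have "(\<Sum>p\<in>parcs G. f (case p of (u, v) \<Rightarrow> Upair u v)) = 2 * (\<Sum>e\<in>uedges G. f e)"
    unfolding sum.image_gen[OF pair_finite_arcs, of _ "\<lambda>(u, v). Upair u v"]
      uedges_def[symmetric] sum_distrib_left
  proof (rule sum.cong[OF refl])
    fix e assume "e \<in> uedges G"
    then obtain a b where e: "e = Upair a b" "b \<in> nbr G a" "a \<noteq> b" by (elim uedgesE)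
    then have "{p \<in> parcs G. (case p of (u, v) \<Rightarrow> Upair u v) = e} = {(a, b), (b, a)}"
      using arcs_symmetric by (auto simp: nbr_def)
    moreover have "f (Upair b a) = f (Upair a b)" by (rule arg_cong[of _ _ f]) simp
    ultimately show "(\<Sum>p\<in>{p \<in> parcs G. (case p of (u, v) \<Rightarrow> Upair u v) = e}.
        f (case p of (u, v) \<Rightarrow> Upair u v)) = 2 * f e"
      using e by simp
  qed
  then show ?thesis by (simp add: case_prod_unfold)
qed

lemma vol_eq_uedges: "vol G = 2 * card (uedges G)"
  using sum_arcs_uedges[of "\<lambda>_. 1"] sum_arcs[of "\<lambda>_ _. 1::real"] by (simp add: vol_def deg_def)

lemma sum_uedges_ends: "(\<Sum>e\<in>uedges G. \<Sum>a\<in>set_uprod e. f a) = (\<Sum>u\<in>pverts G. deg G u * f u)"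
proof -
  have "2 * (\<Sum>e\<in>uedges G. \<Sum>a\<in>set_uprod e. f a) = (\<Sum>(u, v)\<in>parcs G. f u + f v)"
    unfolding sum_arcs_uedges[symmetric] by (rule sum.cong) (auto dest: no_loops')
  also have "\<dots> = 2 * (\<Sum>(u, v)\<in>parcs G. f u)"
    using sum_arcs_swap[of "\<lambda>u v. f u"] by (simp add: case_prod_unfold sum.distrib)
  also have "(\<Sum>(u, v)\<in>parcs G. f u) = (\<Sum>u\<in>pverts G. deg G u * f u)"
    by (simp add: sum_arcs deg_def)
  finally show ?thesis by simp
qed

text \<open>Equal ends give the diagonal sum, distinct ends run through the arcs. This evaluates the
  trace of the edge block of the subdivision.\<close>

lemma sum_uedges_pairs:
  "(\<Sum>e\<in>uedges G. \<Sum>a\<in>set_uprod e. \<Sum>b\<in>set_uprod e. f a b) =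
   (\<Sum>u\<in>pverts G. deg G u * f u u) + (\<Sum>u\<in>pverts G. deg G u * avg G (\<lambda>v. f v u) u)"
proof -
  have "2 * (\<Sum>e\<in>uedges G. \<Sum>a\<in>set_uprod e. \<Sum>b\<in>set_uprod e. f a b) =
      (\<Sum>(u, v)\<in>parcs G. (f u u + f v u) + (f v v + f u v))"
    unfolding sum_arcs_uedges[symmetric] by (rule sum.cong) (auto dest: no_loops')
  also have "\<dots> = 2 * (\<Sum>(u, v)\<in>parcs G. f u u + f v u)"
    using sum_arcs_swap[of "\<lambda>u v. f u u + f v u"]
    by (simp add: case_prod_unfold sum.distrib)
  also have "(\<Sum>(u, v)\<in>parcs G. f u u + f v u) =
      (\<Sum>u\<in>pverts G. deg G u * f u u) + (\<Sum>u\<in>pverts G. deg G u * avg G (\<lambda>v. f v u) u)"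
    by (simp add: sum_arcs deg_avg sum.distrib) (simp add: deg_def)
  finally show ?thesis by simp
qed

end

section \<open>One subdivision step\<close>

text \<open>\<open>subdiv_graph\<close> acts on graphs over \<open>svert\<close> only, so the vertex
  type is specialised here.\<close>

locale conn_svert_graph = conn_graph G for G :: "'a svert pair_pre_digraph"
begin

abbreviation "S \<equiv> subdiv_graph G"

lemma pverts_subdiv: "pverts S = Old ` pverts G \<union> Mid ` uedges G"
  by (simp add: subdiv_graph_def)

lemma nbr_subdiv_Old: "nbr S (Old u) = (\<lambda>v. Mid (Upair u v)) ` nbr G u"
proof -
  have "nbr S (Old u) = Mid ` {e \<in> uedges G. u \<in> set_uprod e}"
    unfolding nbr_def subdiv_graph_def by auto
  also have "{e \<in> uedges G. u \<in> set_uprod e} = Upair u ` nbr G u"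
    using nbr_sym by (auto simp: Upair_in_uedges elim!: uedgesE)
  finally show ?thesis by (simp add: image_image)
qed

lemma nbr_subdiv_Mid: "e \<in> uedges G \<Longrightarrow> nbr S (Mid e) = Old ` set_uprod e"
  unfolding nbr_def subdiv_graph_def by auto

lemma inj_Mid_Upair: "inj_on (\<lambda>v. Mid (Upair u v)) A"
  by (auto simp: inj_on_def)

lemma deg_subdiv_Old: "deg S (Old u) = deg G u"
  unfolding deg_def nbr_subdiv_Old card_image[OF inj_Mid_Upair] ..

lemma deg_subdiv_Mid: "e \<in> uedges G \<Longrightarrow> deg S (Mid e) = 2"
  unfolding deg_def by (simp add: nbr_subdiv_Mid card_image inj_on_def card_set_uprod)

lemma avg_subdiv_Old: "avg S f (Old u) = avg G (\<lambda>v. f (Mid (Upair u v))) u"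
  unfolding avg_def deg_subdiv_Old nbr_subdiv_Old by (simp add: sum.reindex[OF inj_Mid_Upair])

lemma avg_subdiv_Mid: "e \<in> uedges G \<Longrightarrow> avg S f (Mid e) = (\<Sum>a\<in>set_uprod e. f (Old a)) / 2"
  unfolding avg_def by (simp add: deg_subdiv_Mid nbr_subdiv_Mid sum.reindex inj_on_def)

lemma sum_pverts_subdiv:
  "(\<Sum>x\<in>pverts S. f x) = (\<Sum>u\<in>pverts G. f (Old u)) + (\<Sum>e\<in>uedges G. f (Mid e))"
  unfolding pverts_subdiv
  by (subst sum.union_disjoint)
    (auto simp: pair_finite_verts finite_uedges sum.reindex inj_on_def)

lemma card_pverts_subdiv: "card (pverts S) = card (pverts G) + card (uedges G)"
  unfolding pverts_subdiv
  by (subst card_Un_disjoint)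
    (auto simp: pair_finite_verts finite_uedges card_image inj_on_def)

lemma vol_subdiv: "vol S = 2 * vol G"
proof -
  have "vol S = vol G + 2 * card (uedges G)"
    unfolding vol_def by (simp add: sum_pverts_subdiv deg_subdiv_Old deg_subdiv_Mid)
  then show ?thesis by (simp add: vol_eq_uedges)
qed

lemma conn_graph_subdiv: "conn_graph S"
proof
  fix e assume "e \<in> parcs S"
  then show "fst e \<in> pverts S" "snd e \<in> pverts S"
    using set_uprod_verts unfolding subdiv_graph_def by auto
next
  show "finite (pverts S)"
    unfolding pverts_subdiv using pair_finite_verts finite_uedges by simp
  have "parcs S \<subseteq> pverts S \<times> pverts S"
    using set_uprod_verts unfolding subdiv_graph_def by auto
  then show "finite (parcs S)"
    using \<open>finite (pverts S)\<close> finite_subset by blast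
next
  fix e assume "e \<in> parcs S"
  then show "fst e \<noteq> snd e" unfolding subdiv_graph_def by auto
next
  show "symmetric (with_proj S)"
    unfolding symmetric_def sym_def subdiv_graph_def by auto
next
  let ?R = "(parcs S)\<^sup>*"
  have arc: "(Old u, Mid e) \<in> ?R" "(Mid e, Old u) \<in> ?R" if "e \<in> uedges G" "u \<in> set_uprod e" for u e
    using that unfolding subdiv_graph_def by auto
  \<comment> \<open>Each arc of a path in \<open>G\<close> becomes a detour of two arcs through its
    inserted vertex.\<close>
  have old: "(Old u, Old v) \<in> ?R" if "(u, v) \<in> (parcs G)\<^sup>*" for u v
    using that
  proof induction
    case (step v w)
    then have "Upair v w \<in> uedges G" by (simp add: Upair_in_uedges nbr_def)
    then have "(Old v, Old w) \<in> ?R"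
      using arc(1)[of "Upair v w" v] arc(2)[of "Upair v w" w] by (auto intro: rtrancl_trans)
    with step.IH show ?case by (rule rtrancl_trans)
  qed simp
  \<comment> \<open>This reduces reachability in \<open>S\<close> to reachability between old
    vertices.\<close>
  have near: "\<exists>u\<in>pverts G. (x, Old u) \<in> ?R \<and> (Old u, x) \<in> ?R" if "x \<in> pverts S" for x
    using that unfolding pverts_subdiv
  proof
    assume "x \<in> Mid ` uedges G"
    then obtain u v where "x = Mid (Upair u v)" "Upair u v \<in> uedges G" "u \<in> pverts G"
      by (auto elim!: uedgesE simp: Upair_in_uedges)
    then show ?thesis using arc[of "Upair u v" u] by auto
  qed auto
  fix x y assume "x \<in> pverts S" "y \<in> pverts S"
  then obtain u v where "u \<in> pverts G" "v \<in> pverts G" "(x, Old u) \<in> ?R" "(Old v, y) \<in> ?R"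
    using near by meson
  with old[OF reach[of u v]] show "(x, y) \<in> ?R" by (meson rtrancl_trans)
next
  show "2 \<le> card (pverts S)" using two_verts by (simp add: card_pverts_subdiv)
qed

text \<open>Both the vertex count and the edge count grow by the number of edges of
  \<open>G\<close>. The new edge count is read off from the doubled volume.\<close>

lemma circuit_rank_subdiv: "circuit_rank S = circuit_rank G"
proof -
  interpret S: conn_graph S by (rule conn_graph_subdiv)
  have "real (card (uedges S)) = 2 * real (card (uedges G))"
    using S.vol_eq_uedges vol_subdiv vol_eq_uedges by simp
  then have "card (uedges S) = 2 * card (uedges G)" by linarith
  then show ?thesis unfolding circuit_rank_def card_pverts_subdiv by simp
qed

end

text \<open>
  Write \<open>P\<^sub>S = ((0, B), (C, 0))\<close> in blocks, with \<open>B\<close> mapping edges to vertices and \<open>C\<close> vertices to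
  edges. As \<open>B C = (I + P) / 2\<close>, block elimination reduces the equation for the subdivision to the
  one for \<open>G\<close> and gives the solution \<open>((2 M, 2 M B), (2 C M - \<pi> / 2, 2 C M B + I - 1 / vol G))\<close>.
\<close>

fun subdiv_matrix ::
  "'a svert pair_pre_digraph \<Rightarrow> ('a svert \<Rightarrow> 'a svert \<Rightarrow> real) \<Rightarrow> 'a svert \<Rightarrow> 'a svert \<Rightarrow> real" where
  "subdiv_matrix G M (Old u) (Old v) = 2 * M u v"
| "subdiv_matrix G M (Old u) (Mid e') = 2 * (\<Sum>b\<in>set_uprod e'. M u b / deg G b)"
| "subdiv_matrix G M (Mid e) (Old v) = (\<Sum>a\<in>set_uprod e. M a v) - deg G v / (2 * vol G)"
| "subdiv_matrix G M (Mid e) (Mid e') =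
     (\<Sum>a\<in>set_uprod e. \<Sum>b\<in>set_uprod e'. M a b / deg G b) + of_bool (e = e') - 1 / vol G"
| "subdiv_matrix G M _ _ = 0"

context conn_svert_graph
begin

lemma sum_set_uprod_nbr: "v \<in> nbr G u \<Longrightarrow> (\<Sum>a\<in>set_uprod (Upair u v). f a) = f u + f v"
  using no_loops' by (auto simp: nbr_def)

lemma fundamental_subdiv:
  assumes M: "fundamental G M"
  shows "fundamental S (subdiv_matrix G M)"
  unfolding fundamental_def
proof (intro ballI)
  let ?M = "subdiv_matrix G M"
  \<comment> \<open>\<open>Y e\<close> is column \<open>e\<close> of \<open>M B\<close>.\<close>
  define Y where "Y e u = (\<Sum>b\<in>set_uprod e. M u b / deg G b)" for e u
  have Meq: "M u v - avg G (\<lambda>w. M w v) u = of_bool (u = v) - deg G v / vol G"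
    if "u \<in> pverts G" "v \<in> pverts G" for u v
    using M that unfolding fundamental_def by blast
  \<comment> \<open>The right-hand side is the entry of \<open>B\<close> at \<open>u\<close> and
    \<open>e\<close>: just one neighbour of \<open>u\<close> completes \<open>e\<close> if
    \<open>u\<close> is an end of it.\<close>
  have hit_edge: "avg G (\<lambda>w. of_bool (Upair u w = e)) u = of_bool (u \<in> set_uprod e) / deg G u"
    if e: "e \<in> uedges G" for u e
  proof (cases "u \<in> set_uprod e")
    case True
    then obtain c where c: "e = Upair u c" "c \<in> nbr G u"
      using e nbr_sym by (auto elim!: uedgesE)
    have "(\<Sum>w\<in>nbr G u. of_bool (Upair u w = e) :: real) = (\<Sum>w\<in>nbr G u. if w = c then 1 else 0)"
      using c by (intro sum.cong) auto
    with c True show ?thesis unfolding avg_def by simp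
  next
    case False
    then show ?thesis unfolding avg_def by (auto intro!: sum.neutral)
  qed
  \<comment> \<open>The equation for \<open>M\<close>, multiplied by \<open>B\<close> on the right.
    Each end of \<open>e\<close> contributes \<open>1 / vol G\<close> to
    \<open>pi B\<close>.\<close>
  have Yeq: "Y e u - avg G (Y e) u = of_bool (u \<in> set_uprod e) / deg G u - 2 / vol G"
    if e: "e \<in> uedges G" and u: "u \<in> pverts G" for e u
  proof -
    have "avg G (Y e) u = (\<Sum>b\<in>set_uprod e. avg G (\<lambda>w. M w b / deg G b) u)"
      unfolding Y_def by (rule avg_sum)
    also have "\<dots> = (\<Sum>b\<in>set_uprod e. avg G (\<lambda>w. M w b) u / deg G b)"
      using avg_scale[of "1 / deg G b" "\<lambda>w. M w b" u for b] by simp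
    finally have "Y e u - avg G (Y e) u =
        (\<Sum>b\<in>set_uprod e. (M u b - avg G (\<lambda>w. M w b) u) / deg G b)"
      unfolding Y_def by (simp add: sum_subtractf diff_divide_distrib)
    also have "\<dots> = (\<Sum>b\<in>set_uprod e. (if b = u then 1 / deg G u else 0) - 1 / vol G)"
    proof (rule sum.cong[OF refl])
      fix b assume "b \<in> set_uprod e"
      then have b: "b \<in> pverts G" using e by (rule set_uprod_verts[rotated])
      then show "(M u b - avg G (\<lambda>w. M w b) u) / deg G b =
          (if b = u then 1 / deg G u else 0) - 1 / vol G"
        unfolding Meq[OF u b] using deg_pos[OF b] by (simp add: diff_divide_distrib)
    qed
    also have "\<dots> = of_bool (u \<in> set_uprod e) / deg G u - 2 / vol G"
      by (simp add: sum_subtractf card_set_uprod[OF e])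
    finally show ?thesis .
  qed
  fix x y assume "x \<in> pverts S" "y \<in> pverts S"
  then consider
      (OO) u v where "x = Old u" "y = Old v" "u \<in> pverts G" "v \<in> pverts G"
    | (OM) u e where "x = Old u" "y = Mid e" "u \<in> pverts G" "e \<in> uedges G"
    | (MO) e v where "x = Mid e" "y = Old v" "e \<in> uedges G" "v \<in> pverts G"
    | (MM) e e' where "x = Mid e" "y = Mid e'" "e \<in> uedges G" "e' \<in> uedges G"
    unfolding pverts_subdiv by blast
  then show "?M x y - avg S (\<lambda>z. ?M z y) x = of_bool (x = y) - deg S y / vol S"
  proof cases
    case OO
    \<comment> \<open>The average is \<open>M + P M\<close> up to the shift. The shift halves
      \<open>deg G v / vol G\<close>, as the doubled volume requires.\<close>
    have "avg S (\<lambda>z. ?M z y) x = avg G (\<lambda>w. (M u v - deg G v / (2 * vol G)) + M w v) u"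
      unfolding OO avg_subdiv_Old
      by (rule avg_cong) (simp add: sum_set_uprod_nbr del: set_uprod_simps)
    also have "\<dots> = M u v - deg G v / (2 * vol G) + avg G (\<lambda>w. M w v) u"
      using OO by (simp only: avg_add avg_const)
    finally show ?thesis
      using OO Meq[of u v] by (simp add: deg_subdiv_Old vol_subdiv)
  next
    case OM
    \<comment> \<open>The identity in the edge block contributes the entry of \<open>B\<close> that
      cancels the one from \<open>Yeq\<close>.\<close>
    have "avg S (\<lambda>z. ?M z y) x =
        avg G (\<lambda>w. (Y e u - 1 / vol G) + (Y e w + of_bool (Upair u w = e))) u"
      unfolding OM avg_subdiv_Old
      by (rule avg_cong) (simp add: sum_set_uprod_nbr Y_def del: set_uprod_simps)
    also have "\<dots> = Y e u - 1 / vol G + (avg G (Y e) u + of_bool (u \<in> set_uprod e) / deg G u)"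
      using OM by (simp only: avg_add avg_const hit_edge)
    finally show ?thesis
      using OM Yeq[of e u] by (simp add: deg_subdiv_Mid vol_subdiv Y_def)
  next
    \<comment> \<open>For rows of inserted vertices no equation for \<open>M\<close> is needed: the
      average over the two ends cancels the sums, and the correction terms left over are the
      right-hand side.\<close>
    case MO
    then show ?thesis
      by (simp add: avg_subdiv_Mid deg_subdiv_Old vol_subdiv sum_distrib_left[symmetric])
  next
    case MM
    then show ?thesis
      by (simp add: avg_subdiv_Mid deg_subdiv_Mid vol_subdiv sum_distrib_left[symmetric])
  qed
qed

lemma kemeny_subdiv: "kemeny S = 4 * kemeny G + circuit_rank G - 1 / 2"
proof -
  interpret S: conn_graph S by (rule conn_graph_subdiv)
  obtain M where M: "fundamental G M" using ex_fundamental ..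
  let ?M = "subdiv_matrix G M" and ?N = "real (card (pverts G))" and ?E = "real (card (uedges G))"
  let ?tr = "\<Sum>u\<in>pverts G. M u u"
  obtain i where i: "i \<in> pverts G" using two_verts by fastforce
  let ?row = "\<Sum>v\<in>pverts G. M i v"
  \<comment> \<open>The trace of \<open>2 C M B\<close>: equal ends give \<open>tr M\<close>,
    distinct ends give \<open>tr (P M)\<close>, which the diagonal of the equation for
    \<open>M\<close> turns into \<open>tr M - N + 1\<close>.\<close>
  have "(\<Sum>e\<in>uedges G. \<Sum>a\<in>set_uprod e. \<Sum>b\<in>set_uprod e. M a b / deg G b) =
      (\<Sum>u\<in>pverts G. deg G u * (M u u / deg G u)) +
      (\<Sum>u\<in>pverts G. deg G u * avg G (\<lambda>v. M v u / deg G u) u)"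
    by (rule sum_uedges_pairs)
  also have "(\<Sum>u\<in>pverts G. deg G u * (M u u / deg G u)) = ?tr"
    using deg_pos by (intro sum.cong) force+
  also have "(\<Sum>u\<in>pverts G. deg G u * avg G (\<lambda>v. M v u / deg G u) u) =
      (\<Sum>u\<in>pverts G. M u u - 1 + deg G u / vol G)"
  proof (rule sum.cong[OF refl])
    fix u assume u: "u \<in> pverts G"
    have "avg G (\<lambda>v. M v u / deg G u) u = avg G (\<lambda>v. M v u) u / deg G u"
      using avg_scale[of "1 / deg G u" "\<lambda>v. M v u" u] by simp
    moreover have "M u u - avg G (\<lambda>v. M v u) u = 1 - deg G u / vol G"
      using M u unfolding fundamental_def by fastforce
    ultimately show "deg G u * avg G (\<lambda>v. M v u / deg G u) u = M u u - 1 + deg G u / vol G"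
      using deg_pos[OF u] by simp
  qed
  also have "\<dots> = ?tr - ?N + 1"
    using vol_pos by (simp add: sum.distrib sum_subtractf sum_divide_distrib[symmetric] vol_def[symmetric])
  finally have "(\<Sum>x\<in>pverts S. ?M x x) = 4 * ?tr - ?N + 1 + ?E - ?E / vol G"
    by (simp add: sum_pverts_subdiv sum.distrib sum_subtractf sum_distrib_left[symmetric])
  also have "?E / vol G = 1 / 2"
    using vol_pos by (simp add: vol_eq_uedges)
  finally have tr: "(\<Sum>x\<in>pverts S. ?M x x) = 4 * ?tr + circuit_rank G - 1 / 2"
    by (simp add: circuit_rank_def)
  \<comment> \<open>In the row of an old vertex, summing over edges cancels the factors
    \<open>1 / deg G u\<close>, so the edge columns contribute as much as the old ones.\<close>
  have "(\<Sum>y\<in>pverts S. ?M (Old i) y) =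
      2 * ?row + 2 * (\<Sum>u\<in>pverts G. deg G u * (M i u / deg G u))"
    by (simp only: sum_pverts_subdiv subdiv_matrix.simps sum_distrib_left[symmetric] sum_uedges_ends)
  also have "(\<Sum>u\<in>pverts G. deg G u * (M i u / deg G u)) = ?row"
    using deg_pos by (intro sum.cong) force+
  finally have row: "(\<Sum>y\<in>pverts S. ?M (Old i) y) = 4 * ?row" by simp
  have "kemeny S = (\<Sum>x\<in>pverts S. ?M x x) - (\<Sum>y\<in>pverts S. ?M (Old i) y)"
    using i by (intro S.kemeny_eq_trace fundamental_subdiv M) (simp add: pverts_subdiv)
  moreover have "kemeny G = ?tr - ?row"
    using M i by (rule kemeny_eq_trace)
  ultimately show ?thesis by (simp add: tr row)
qed

end

section \<open>The base copy\<close>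

context conn_graph
begin

abbreviation "G\<^sub>0 \<equiv> base_copy G"

lemma conn_graph_base_copy: "conn_graph G\<^sub>0"
proof
  fix e assume "e \<in> parcs G\<^sub>0"
  then show "fst e \<in> pverts G\<^sub>0" "snd e \<in> pverts G\<^sub>0" "fst e \<noteq> snd e"
    using in_arcsD1 in_arcsD2 no_loops' unfolding base_copy_def by auto
next
  show "finite (pverts G\<^sub>0)" "finite (parcs G\<^sub>0)"
    using pair_finite_verts pair_finite_arcs unfolding base_copy_def by auto
next
  show "symmetric (with_proj G\<^sub>0)"
    using arcs_symmetric unfolding symmetric_def sym_def base_copy_def by auto
next
  have base: "(Base u, Base v) \<in> (parcs G\<^sub>0)\<^sup>*" if "(u, v) \<in> (parcs G)\<^sup>*" for u v
    using that
  proof induction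
    case (step v w)
    then have "(Base v, Base w) \<in> parcs G\<^sub>0" unfolding base_copy_def by force
    with step.IH show ?case by simp
  qed simp
  fix x y assume "x \<in> pverts G\<^sub>0" "y \<in> pverts G\<^sub>0"
  then show "(x, y) \<in> (parcs G\<^sub>0)\<^sup>*"
    using base reach unfolding base_copy_def by auto
next
  show "2 \<le> card (pverts G\<^sub>0)"
    using two_verts unfolding base_copy_def by (simp add: card_image inj_on_def)
qed

lemma circuit_rank_base_copy: "circuit_rank G\<^sub>0 = circuit_rank G"
proof -
  have "uedges G\<^sub>0 = map_uprod Base ` uedges G"
    unfolding uedges_def base_copy_def by (force simp: image_image)
  moreover have "inj (map_uprod Base)" by (intro uprod.inj_map injI) simp
  ultimately have "card (uedges G\<^sub>0) = card (uedges G)"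
    by (metis card_image inj_on_subset subset_UNIV)
  then show ?thesis
    unfolding circuit_rank_def by (simp add: base_copy_def card_image inj_on_def)
qed

text \<open>Relabelling a solution of the matrix equation suffices, so the walks on the two graphs
  need not be compared. The value 0 of \<open>M\<^sub>0\<close> concerns only labels outside the
  copy.\<close>

lemma kemeny_base_copy: "kemeny G\<^sub>0 = kemeny G"
proof -
  interpret B: conn_graph "G\<^sub>0" by (rule conn_graph_base_copy)
  obtain M where M: "fundamental G M" using ex_fundamental ..
  define M\<^sub>0 where "M\<^sub>0 x y = (case (x, y) of (Base u, Base v) \<Rightarrow> M u v | _ \<Rightarrow> 0)" for x y
  have M\<^sub>0: "M\<^sub>0 (Base u) (Base v) = M u v" for u v by (simp add: M\<^sub>0_def)
  have sum: "(\<Sum>x\<in>Base ` A. f x) = (\<Sum>u\<in>A. f (Base u))" for A :: "'a set" and f :: "_ \<Rightarrow> real"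
    by (simp add: sum.reindex inj_on_def)
  have V: "pverts G\<^sub>0 = Base ` pverts G" by (simp add: base_copy_def)
  have nbr: "nbr G\<^sub>0 (Base u) = Base ` nbr G u" for u
    unfolding nbr_def base_copy_def by force
  have deg: "deg G\<^sub>0 (Base u) = deg G u" for u
    unfolding deg_def nbr by (simp add: card_image inj_on_def)
  have avg: "avg G\<^sub>0 f (Base u) = avg G (\<lambda>v. f (Base v)) u" for f u
    unfolding avg_def nbr deg sum ..
  have vol: "vol G\<^sub>0 = vol G" unfolding vol_def V sum deg ..
  have F: "fundamental G\<^sub>0 M\<^sub>0"
    using M unfolding fundamental_def V by (auto simp: avg deg vol M\<^sub>0)
  obtain i where i: "i \<in> pverts G" using two_verts by fastforce
  have "kemeny G\<^sub>0 = (\<Sum>j\<in>pverts G. M j j) - (\<Sum>j\<in>pverts G. M i j)"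
    using B.kemeny_eq_trace[OF F, of "Base i"] i by (simp add: V sum M\<^sub>0)
  then show ?thesis using kemeny_eq_trace[OF M i] by simp
qed

section \<open>Iteration of the subdivision step\<close>

lemma conn_graph_iter_subdiv:
  "conn_graph (iter_subdiv n G) \<and> circuit_rank (iter_subdiv n G) = circuit_rank G"
proof (induction n)
  case 0
  show ?case by (simp add: iter_subdiv_def conn_graph_base_copy circuit_rank_base_copy)
next
  case (Suc n)
  then interpret I: conn_svert_graph "iter_subdiv n G" by (simp add: conn_svert_graph_def)
  show ?case
    using I.conn_graph_subdiv I.circuit_rank_subdiv Suc by (simp add: iter_subdiv_def)
qed

lemma kemeny_iter_subdiv_Suc:
  "kemeny (iter_subdiv (Suc n) G) = 4 * kemeny (iter_subdiv n G) + circuit_rank G - 1 / 2"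
proof -
  interpret I: conn_svert_graph "iter_subdiv n G"
    using conn_graph_iter_subdiv by (simp add: conn_svert_graph_def)
  show ?thesis
    using I.kemeny_subdiv conn_graph_iter_subdiv[of n] by (simp add: iter_subdiv_def)
qed

lemma kemeny_iter_subdiv:
  "kemeny (iter_subdiv n G) = 4 ^ n * kemeny G + (4 ^ n - 1) / 3 * (circuit_rank G - 1 / 2)"
proof (induction n)
  case 0
  show ?case by (simp add: iter_subdiv_def kemeny_base_copy)
next
  case (Suc n)
  show ?case unfolding kemeny_iter_subdiv_Suc Suc by (simp add: field_simps)
qed

end

lemma conn_graphI:
  assumes "pair_graph G" "Digraph_Component.connected (with_proj G)" "card (pverts G) \<ge> 2"
  shows "conn_graph G"
proof -
  interpret pair_graph G by fact
  show ?thesis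
  proof
    fix u v assume uv: "u \<in> pverts G" "v \<in> pverts G"
    \<comment> \<open>Connectedness is defined through the symmetric closure, which adds no
      reachability to a graph that is already symmetric.\<close>
    have "u \<rightarrow>\<^sup>*\<^bsub>with_proj (mk_symmetric (with_proj G))\<^esub> v"
      using assms(2) uv unfolding Digraph_Component.connected_def strongly_connected_def by simp
    then have "u \<rightarrow>\<^sup>*\<^bsub>with_proj G\<^esub> v"
      using reachable_mk_symmetric_eq[OF pair_sym_arcs] by simp
    then show "(u, v) \<in> (parcs G)\<^sup>*"
      unfolding reachable_def using rtrancl_on_sub_rtrancl by auto
  qed (fact assms)
qed

theorem theorem2:
  fixes G :: "'a pair_pre_digraph" and r :: real
  assumes "pair_graph G"
    and "Digraph_Component.connected (with_proj G)"
    and "card (pverts G) \<ge> 2"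
    and "r = of_int (circuit_rank G)"
  shows "\<forall>n>0.
      kemeny (iter_subdiv n G) = 4 * kemeny (iter_subdiv (n - 1) G) + r - 1 / 2
    \<and> kemeny (iter_subdiv n G) = 4 ^ n * kemeny G + (4 ^ n - 1) / 3 * (r - 1 / 2)"
proof -
  interpret conn_graph G using assms(1-3) by (rule conn_graphI)
  show ?thesis
    using kemeny_iter_subdiv_Suc kemeny_iter_subdiv assms(4) by (metis Suc_diff_1)
qed

end
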